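(* Let $B=5$, let $\tilde p\neq0$ be an integer and $\tilde q$ a positive integer with $\tilde q\geqslant 3600\sqrt[3]{|\tilde p|}$. Let $F_2=B^{2}\tilde q^{6}-2B\tilde q^{4}-2B\tilde p\tilde q^{3}-2\tilde q^{2}+2\tilde p\tilde q+\tilde p^{2}-\frac5B-\frac{20}{B^{2}\tilde q^{2}}$, and consider the set of real $t$ with $F_2<t<F_2-\frac{10\tilde p}{B^{2}\tilde q^{3}}$ if $\tilde p<0$, respectively $F_2-\frac{10\tilde p}{B^{2}\tilde q^{3}}<t<F_2$ if $\tilde p>0$. This set contains at most one integer; an integer can occur only when $\tilde p<0$, and then it is $t=25\tilde q^{6}-10\tilde q^{4}-10\tilde p\tilde q^{3}-2\tilde q^{2}+2\tilde p\tilde q+\tilde p^{2}-1$. *)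

theory Defs
  imports Complex_Main
begin

definition F2 :: "real \<Rightarrow> int \<Rightarrow> int \<Rightarrow> real" where
  "F2 B p q =
     B^2 * of_int q^6 - 2 * B * of_int q^4 - 2 * B * of_int p * of_int q^3
     - 2 * of_int q^2 + 2 * of_int p * of_int q + of_int p^2
     - 5 / B - 20 / (B^2 * of_int q^2)"

text \<open>Only nonzero \<open>p\<close> is of interest; for \<open>p = 0\<close> the set is empty.\<close>

definition t_range :: "real \<Rightarrow> int \<Rightarrow> int \<Rightarrow> real set" where
  "t_range B p q =
     (if p < 0
      then {t. F2 B p q < t \<and> t < F2 B p q - 10 * of_int p / (B^2 * of_int q^3)}
      else {t. F2 B p q - 10 * of_int p / (B^2 * of_int q^3) < t \<and> t < F2 B p q})"

end

theory Submission
  imports Defs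
begin

text \<open>
  For \<open>B = 5\<close> one has \<open>F\<^sub>2 = T - 4 / (5 q\<^sup>2)\<close>, where \<open>T\<close> is the integer of the theorem, and the
  interval has length \<open>2 \<bar>p\<bar> / (5 q\<^sup>3)\<close>, which the lower bound on \<open>q\<close> makes tiny. It therefore lies
  strictly between \<open>T - 1\<close> and \<open>T + 1\<close>, and it lies below \<open>T\<close> when \<open>p > 0\<close>.
\<close>

lemma cube_ge_of_ge_root3:
  fixes c x y :: real
  assumes "0 \<le> c" "0 \<le> y" "c * root 3 y \<le> x"
  shows "c ^ 3 * y \<le> x ^ 3"
proof -
  have "(c * root 3 y) ^ 3 \<le> x ^ 3"
    using assms by (intro power_mono) auto
  then show ?thesis
    using assms(2) by (simp add: power_mult_distrib)
qed

theorem theorem7p8: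
  fixes B :: real and p q :: int
  assumes "B = 5"
    and "p \<noteq> 0"
    and "q > 0"
    and "real_of_int q \<ge> 3600 * root 3 \<bar>real_of_int p\<bar>"
  shows "(\<exists>\<^sub>\<le>\<^sub>1 t::int. real_of_int t \<in> t_range B p q)
    \<and> (\<forall>t::int. real_of_int t \<in> t_range B p q \<longrightarrow>
          p < 0 \<and>
          t = 25 * q^6 - 10 * q^4 - 10 * p * q^3 - 2 * q^2 + 2 * p * q + p^2 - 1)"
proof -
  define T where
    "T = 25 * q^6 - 10 * q^4 - 10 * p * q^3 - 2 * q^2 + 2 * p * q + p^2 - 1"
  define e where "e = 4 / (5 * real_of_int q ^ 2)"
  define d where "d = 2 * real_of_int p / (5 * real_of_int q ^ 3)"
  have q1: "1 \<le> real_of_int q"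
    using assms(3) by simp
  have F2: "F2 B p q = real_of_int T - e"
    by (simp add: F2_def T_def e_def assms(1))
  have d: "10 * real_of_int p / (B ^ 2 * real_of_int q ^ 3) = d"
    by (simp add: d_def assms(1))
  have e_pos: "0 < e"
    using q1 by (simp add: e_def)
  have e_le: "e \<le> 4 / 5"
    using one_le_power[OF q1, of 2] q1 by (simp add: e_def divide_le_eq)
  have "3600 ^ 3 * \<bar>real_of_int p\<bar> \<le> real_of_int q ^ 3"
    using assms(4) by (intro cube_ge_of_ge_root3) auto
  \<comment> \<open>The factor 4 yields \<open>\<bar>d\<bar> \<le> (2/5) / 4 = 1/10\<close>; with
    \<open>e \<le> 4/5\<close> this keeps \<open>e + \<bar>d\<bar>\<close> below 1.\<close>
  then have "4 * \<bar>real_of_int p\<bar> \<le> real_of_int q ^ 3"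
    by simp
  then have d_le: "\<bar>d\<bar> \<le> 1 / 10"
    using q1 by (simp add: d_def abs_mult divide_le_eq)
  have main: "p < 0 \<and> t = T" if t: "real_of_int t \<in> t_range B p q" for t
  proof (cases "p < 0")
    case True
    then have "real_of_int T - e < real_of_int t" "real_of_int t < real_of_int T - e - d"
      using t by (simp_all add: t_range_def F2 d)
    \<comment> \<open>Since \<open>e > 0\<close>, the upper end exceeds \<open>T\<close> by less
      than 1/10, so \<open>T\<close> is the only integer left.\<close>
    then have "T - 1 < t" "t < T + 1"
      using e_pos e_le d_le by linarith+
    then show ?thesis
      using True by simp
  next
    case False
    then have "real_of_int T - e - d < real_of_int t" "real_of_int t < real_of_int T - e"
      using t by (simp_all add: t_range_def F2 d)
    \<comment> \<open>No integer lies strictly between \<open>T - 1\<close> and \<open>T\<close>, so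
      this case is contradictory.\<close>
    then have "T - 1 < t" "t < T"
      using e_pos e_le d_le by linarith+
    then show ?thesis
      by simp
  qed
  \<comment> \<open>Uniqueness follows because any two integers in the set both equal
    \<open>T\<close>.\<close>
  then show ?thesis
    unfolding T_def by (auto simp: Uniq_def)
qed

end
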